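(* Let $S\subset\mathbb{R}^n$ be a nonempty closed set containing the origin. For every bounded subset $F$ of the metric space $(\mathrm{usc\text{-}fcns}(S),d)$, there exist $c\ge 0$ and $\bar\varepsilon>0$ (both independent of $n$, the dimension of $S$) such that $$\log N(F,\varepsilon)\ \le\ \left(\frac{c}{\varepsilon}\right)^n\left(\log\frac{1}{\varepsilon}\right)^{n+1}\quad\text{for all }\varepsilon\in(0,\bar\varepsilon].$$
   Context: Let $\overline{\mathbb{R}}=[-\infty,\infty]$. Here $n$ is the dimension of the space $\mathbb{R}^n$ containing $S$. For $f:S\to\overline{\mathbb{R}}$, the hypograph is $\mathrm{hypo} f=\{(x,\alpha)\in S\times\mathbb{R}: f(x)\ge\alpha\}$, and $\mathrm{usc\text{-}fcns}(S)=\{f:S\to\overline{\mathbb{R}}:\mathrm{hypo} f\text{ is nonempty and closed}\}$. The Attouch–Wets distance on $\mathrm{usc\text{-}fcns}(S)$ is $$d(f,g)=\int_0^\infty d_\rho(f,g)\,e^{-\rho}\,d\rho,\qquad d_\rho(f,g)=\max_{z\in S\times\mathbb{R},\ \|z\|_\infty\le\rho}\big|\mathrm{dist}_\infty(z,\mathrm{hypo} f)-\mathrm{dist}_\infty(z,\mathrm{hypo} g)\big|,$$ where $\mathrm{dist}_\infty(z,A)=\inf_{a\in A}\|z-a\|_\infty$. It is a metric on $\mathrm{usc\text{-}fcns}(S)$, and "bounded" is meant with respect to this metric. The covering number $N(F,\varepsilon)$ is the smallest number of closed $d$-balls $\{g\in\mathrm{usc\text{-}fcns}(S): d(f_0,g)\le\varepsilon\}$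 of radius $\varepsilon$ (with centers $f_0\in\mathrm{usc\text{-}fcns}(S)$) needed to cover $F$. *)

theory Defs
  imports "HOL-Analysis.Analysis"
begin

text \<open>
  The dimension \<open>n\<close> is quantified inside the theorem, so \<open>\<real>\<^sup>n\<close> is the library's
  \<^const>\<open>Euclidean_space\<close> \<open>n\<close>, whose points are the sequences vanishing from index \<open>n\<close> on;
  points of \<open>\<real>\<^sup>n \<times> \<real>\<close> are pairs.
\<close>

definition sup_norm :: "nat \<Rightarrow> (nat \<Rightarrow> real) \<times> real \<Rightarrow> real" where
  "sup_norm n z = Max (insert \<bar>snd z\<bar> ((\<lambda>i. \<bar>fst z i\<bar>) ` {..<n}))"

definition dist_inf :: "nat \<Rightarrow> (nat \<Rightarrow> real) \<times> real \<Rightarrow> ((nat \<Rightarrow> real) \<times> real) set \<Rightarrow> real" where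
  "dist_inf n z A = (INF a\<in>A. sup_norm n (z - a))"

definition hypo :: "(nat \<Rightarrow> real) set \<Rightarrow> ((nat \<Rightarrow> real) \<Rightarrow> ereal) \<Rightarrow> ((nat \<Rightarrow> real) \<times> real) set" where
  "hypo S f = {(x, \<alpha>). x \<in> S \<and> ereal \<alpha> \<le> f x}"

text \<open>Functions on \<open>S\<close> are made unique representatives by \<^const>\<open>extensional\<close>.\<close>

definition usc_fcns :: "nat \<Rightarrow> (nat \<Rightarrow> real) set \<Rightarrow> ((nat \<Rightarrow> real) \<Rightarrow> ereal) set" where
  "usc_fcns n S = {f \<in> extensional S. hypo S f \<noteq> {} \<and>
     closedin (prod_topology (Euclidean_space n) euclideanreal) (hypo S f)}"

text \<open>
  For closed \<open>S\<close> containing the origin and \<open>\<rho> \<ge> 0\<close> the supremum below is over a nonempty compact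
  set on which the expression is continuous, so it is the maximum.
\<close>

definition aw_rho ::
  "nat \<Rightarrow> (nat \<Rightarrow> real) set \<Rightarrow> real \<Rightarrow> ((nat \<Rightarrow> real) \<Rightarrow> ereal) \<Rightarrow> ((nat \<Rightarrow> real) \<Rightarrow> ereal) \<Rightarrow> real" where
  "aw_rho n S \<rho> f g =
     (SUP z\<in>{z \<in> S \<times> UNIV. sup_norm n z \<le> \<rho>}.
        \<bar>dist_inf n z (hypo S f) - dist_inf n z (hypo S g)\<bar>)"

definition aw_dist ::
  "nat \<Rightarrow> (nat \<Rightarrow> real) set \<Rightarrow> ((nat \<Rightarrow> real) \<Rightarrow> ereal) \<Rightarrow> ((nat \<Rightarrow> real) \<Rightarrow> ereal) \<Rightarrow> real" where
  "aw_dist n S f g = (LINT \<rho>:{0..}|lborel. aw_rho n S \<rho> f g * exp (- \<rho>))"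

lemma sup_norm_le_iff: "sup_norm n z \<le> r \<longleftrightarrow> \<bar>snd z\<bar> \<le> r \<and> (\<forall>i<n. \<bar>fst z i\<bar> \<le> r)"
  unfolding sup_norm_def by (subst Max_le_iff) auto

lemma sup_norm_ge: "\<bar>snd z\<bar> \<le> sup_norm n z" "i < n \<Longrightarrow> \<bar>fst z i\<bar> \<le> sup_norm n z"
  using sup_norm_le_iff by blast+

lemma sup_norm_nonneg: "0 \<le> sup_norm n z"
  using sup_norm_ge(1)[of z n] by linarith

lemma sup_norm_0: "sup_norm n (\<lambda>_. 0, 0) = 0"
  using sup_norm_nonneg[of n "(\<lambda>_. 0, 0)"] sup_norm_le_iff[of n "(\<lambda>_. 0, 0)" 0] by simp

lemma sup_norm_triangle: "sup_norm n (z - a) \<le> sup_norm n (z - w) + sup_norm n (w - a)"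
proof -
  have "\<bar>snd z - snd a\<bar> \<le> sup_norm n (z - w) + sup_norm n (w - a)"
    using sup_norm_ge(1)[of "z - w" n] sup_norm_ge(1)[of "w - a" n] by simp
  moreover have "\<bar>fst z i - fst a i\<bar> \<le> sup_norm n (z - w) + sup_norm n (w - a)" if "i < n" for i
    using sup_norm_ge(2)[of i n "z - w"] sup_norm_ge(2)[of i n "w - a"] that by simp
  ultimately show ?thesis by (simp add: sup_norm_le_iff)
qed

lemma sup_norm_commute: "sup_norm n (z - w) = sup_norm n (w - z)"
  by (simp add: sup_norm_def abs_minus_commute)

lemma dist_inf_bdd: "bdd_below ((\<lambda>a. sup_norm n (z - a)) ` A)"
  by (rule bdd_belowI2[where m=0]) (rule sup_norm_nonneg)

lemma dist_inf_le: "a \<in> A \<Longrightarrow> dist_inf n z A \<le> sup_norm n (z - a)"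
  unfolding dist_inf_def by (rule cINF_lower[OF dist_inf_bdd])

lemma dist_inf_nonneg: "A \<noteq> {} \<Longrightarrow> 0 \<le> dist_inf n z A"
  unfolding dist_inf_def by (rule cINF_greatest) (auto simp: sup_norm_nonneg)

lemma dist_inf_Lipschitz: "\<bar>dist_inf n z A - dist_inf n w A\<bar> \<le> sup_norm n (z - w)"
proof (cases "A = {}")
  case True then show ?thesis by (simp add: dist_inf_def sup_norm_nonneg)
next
  case False
  have "dist_inf n z A - sup_norm n (z - w) \<le> dist_inf n w A" for z w
    unfolding dist_inf_def[of n w]
  proof (rule cINF_greatest[OF False])
    fix a assume "a \<in> A"
    show "dist_inf n z A - sup_norm n (z - w) \<le> sup_norm n (w - a)"
      using dist_inf_le[OF \<open>a \<in> A\<close>, of n z] sup_norm_triangle[of n z a w] by linarith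
  qed
  from this[of z w] this[of w z] show ?thesis by (simp add: sup_norm_commute abs_le_iff)
qed

definition aw_gap where
  "aw_gap n S f g z = \<bar>dist_inf n z (hypo S f) - dist_inf n z (hypo S g)\<bar>"

abbreviation "origin \<equiv> (\<lambda>_. 0, 0) :: (nat \<Rightarrow> real) \<times> real"

lemma aw_gap_le: "aw_gap n S f g z \<le> aw_gap n S f g origin + 2 * sup_norm n z"
proof -
  have "z - origin = z" by (simp add: prod_eq_iff fun_eq_iff)
  then show ?thesis
    using dist_inf_Lipschitz[of n z "hypo S f" origin] dist_inf_Lipschitz[of n z "hypo S g" origin]
    unfolding aw_gap_def by simp
qed

lemma aw_gap_bdd: "bdd_above (aw_gap n S f g ` {z \<in> S \<times> UNIV. sup_norm n z \<le> \<rho>})"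
  by (rule bdd_aboveI2[where M="aw_gap n S f g origin + 2 * \<rho>"])
     (use aw_gap_le[of n S f g] in \<open>fastforce intro: order_trans\<close>)

lemma aw_rho_alt: "aw_rho n S \<rho> f g = (SUP z\<in>{z \<in> S \<times> UNIV. sup_norm n z \<le> \<rho>}. aw_gap n S f g z)"
  by (simp add: aw_rho_def aw_gap_def)

lemma aw_gap_le_rho: "z \<in> S \<times> UNIV \<Longrightarrow> sup_norm n z \<le> \<rho> \<Longrightarrow> aw_gap n S f g z \<le> aw_rho n S \<rho> f g"
  unfolding aw_rho_alt by (rule cSUP_upper[OF _ aw_gap_bdd]) auto

lemma ball_ne: "(\<lambda>_. 0) \<in> S \<Longrightarrow> 0 \<le> \<rho> \<Longrightarrow> origin \<in> {z \<in> S \<times> UNIV. sup_norm n z \<le> \<rho>}"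
  by (simp add: sup_norm_0)

lemma aw_rho_nonneg: "(\<lambda>_. 0) \<in> S \<Longrightarrow> 0 \<le> \<rho> \<Longrightarrow> 0 \<le> aw_rho n S \<rho> f g"
  by (rule order_trans[OF _ aw_gap_le_rho[of origin]]) (auto simp: aw_gap_def sup_norm_0)

lemma aw_rho_le: 
  assumes "(\<lambda>_. 0) \<in> S" "0 \<le> \<rho>"
  shows "aw_rho n S \<rho> f g \<le> aw_gap n S f g origin + 2 * \<rho>"
  unfolding aw_rho_alt
proof (rule cSUP_least)
  show "{z \<in> S \<times> UNIV. sup_norm n z \<le> \<rho>} \<noteq> {}" using ball_ne[OF assms] by blast
qed (use aw_gap_le[of n S f g] in \<open>fastforce intro: order_trans\<close>)

lemma aw_rho_mono:
  assumes "(\<lambda>_. 0) \<in> S" "0 \<le> \<rho>" "\<rho> \<le> \<sigma>"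
  shows "aw_rho n S \<rho> f g \<le> aw_rho n S \<sigma> f g"
  unfolding aw_rho_alt
  using ball_ne[OF assms(1,2), of n] assms(3) by (intro cSUP_subset_mono aw_gap_bdd) auto

lemma aw_rho_triangle:
  assumes "(\<lambda>_. 0) \<in> S" "0 \<le> \<rho>"
  shows "aw_rho n S \<rho> f h \<le> aw_rho n S \<rho> f g + aw_rho n S \<rho> g h"
  unfolding aw_rho_alt[of n S \<rho> f h]
proof (rule cSUP_least)
  show "{z \<in> S \<times> UNIV. sup_norm n z \<le> \<rho>} \<noteq> {}" using ball_ne[OF assms] by blast
  fix z assume "z \<in> {z \<in> S \<times> UNIV. sup_norm n z \<le> \<rho>}"
  then have "aw_gap n S f g z \<le> aw_rho n S \<rho> f g" "aw_gap n S g h z \<le> aw_rho n S \<rho> g h"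
    by (auto intro: aw_gap_le_rho)
  then show "aw_gap n S f h z \<le> aw_rho n S \<rho> f g + aw_rho n S \<rho> g h"
    unfolding aw_gap_def by linarith
qed

lemma exp_half_integrable: "set_integrable lborel {0..} (\<lambda>\<rho>::real. exp (- \<rho> / 2))"
proof -
  have "filterlim (\<lambda>x::real. - 1 / 2 * x) at_bot at_top"
    by (rule filterlim_tendsto_neg_mult_at_bot[OF tendsto_const _ filterlim_ident]) simp
  then have "((\<lambda>x::real. - 2 * exp (- 1 / 2 * x)) \<longlongrightarrow> - 2 * 0) at_top"
    by (intro tendsto_intros filterlim_compose[OF exp_at_bot])
  then have "((\<lambda>x::real. - 2 * exp (- x / 2)) \<longlongrightarrow> 0) at_top" by simp
  then have "(\<integral>\<^sup>+x. ennreal (exp (- x / 2)) * indicator {0..} x \<partial>lborel) = ennreal (0 - (- 2 * exp (- 0 / 2)))"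
    by (intro nn_integral_FTC_atLeast) (auto intro!: derivative_eq_intros)
  then show ?thesis
    unfolding set_integrable_def
    by (intro integrableI_nonneg) (auto simp: ennreal_mult' mult.commute ennreal_indicator)
qed

lemma aw_integrable:
  assumes "(\<lambda>_. 0) \<in> S"
  shows "set_integrable lborel {0..} (\<lambda>\<rho>. aw_rho n S \<rho> f g * exp (- \<rho>))"
proof -
  define C where "C = aw_gap n S f g origin"
  have C: "0 \<le> C" by (simp add: C_def aw_gap_def)
  let ?m = "\<lambda>\<rho>. aw_rho n S (max 0 \<rho>) f g"
  have "mono ?m" by (intro monoI aw_rho_mono assms) auto
  then have [measurable]: "?m \<in> borel_measurable borel" by (rule borel_measurable_mono)
  have "set_integrable lborel {0..} (\<lambda>\<rho>. ?m \<rho> * exp (- \<rho>))"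
  proof (rule set_integrable_bound)
    show "set_integrable lborel {0..} (\<lambda>\<rho>. (C + 4) * exp (- \<rho> / 2))"
      using exp_half_integrable by (rule set_integrable_mult_right)
    show "set_borel_measurable lborel {0..} (\<lambda>\<rho>. ?m \<rho> * exp (- \<rho>))"
      unfolding set_borel_measurable_def by measurable
    have "norm (?m x * exp (- x)) \<le> norm ((C + 4) * exp (- x / 2))" if "0 \<le> x" for x
    proof -
      have "?m x \<le> C + 2 * x" using aw_rho_le[OF assms that, of n f g] that by (simp add: C_def)
      also have "\<dots> \<le> (C + 4) * exp (x / 2)"
      proof -
        have "C * 1 \<le> C * exp (x / 2)" by (intro mult_left_mono) (use C that in auto)
        moreover have "1 + x / 2 \<le> exp (x / 2)" by (rule exp_ge_add_one_self)
        ultimately have "C + 2 * x \<le> C * exp (x / 2) + 4 * exp (x / 2)" using that by linarith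
        then show ?thesis by (simp add: algebra_simps)
      qed
      finally have "?m x * exp (- x) \<le> (C + 4) * exp (x / 2) * exp (- x)"
        by (rule mult_right_mono) simp
      also have "\<dots> = (C + 4) * exp (- x / 2)" by (simp add: mult.assoc flip: exp_add)
      finally show ?thesis using aw_rho_nonneg[OF assms, of x n f g] that C by (simp add: abs_mult)
    qed
    then show "AE x in lborel. x \<in> {0..} \<longrightarrow> norm (?m x * exp (- x)) \<le> norm ((C + 4) * exp (- x / 2))"
      by auto
  qed
  moreover have "set_integrable lborel {0..} (\<lambda>\<rho>. ?m \<rho> * exp (- \<rho>)) =
      set_integrable lborel {0..} (\<lambda>\<rho>. aw_rho n S \<rho> f g * exp (- \<rho>))"
    by (rule set_integrable_cong) (auto simp: max_def)
  ultimately show ?thesis by blast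
qed

lemma closed_hypo:
  assumes "closedin (prod_topology (Euclidean_space n) euclideanreal) A"
  shows "closed A" "fst ` A \<subseteq> topspace (Euclidean_space n)"
proof -
  let ?X = "topspace (Euclidean_space n)"
  have E: "Euclidean_space n = subtopology euclidean ?X"
    by (simp add: Euclidean_space_def euclidean_product_topology)
  have P: "prod_topology (Euclidean_space n) euclideanreal = subtopology euclidean (?X \<times> UNIV)"
    by (subst E, subst (2) subtopology_UNIV[symmetric], subst prod_topology_subtopology)
       (simp add: subtopology_subtopology)
  have "closed ?X"
    using closedin_Euclidean_imp_closed[OF closedin_topspace] .
  then have "closed (?X \<times> (UNIV :: real set))" by (intro closed_Times) auto
  then show "closed A"
    using assms unfolding P by (meson closedin_closed_trans)
  show "fst ` A \<subseteq> ?X" using closedin_subset[OF assms] by auto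
qed

lemma dist_inf_pos:
  assumes A: "closedin (prod_topology (Euclidean_space n) euclideanreal) A" "A \<noteq> {}"
    and z: "fst z \<in> topspace (Euclidean_space n)" "z \<notin> A"
  shows "0 < dist_inf n z A"
proof (rule ccontr)
  assume "\<not> 0 < dist_inf n z A"
  then have 0: "(INF a\<in>A. sup_norm n (z - a)) < inverse (real (Suc k))" for k
    unfolding dist_inf_def by (smt (verit) inverse_positive_iff_positive of_nat_0_less_iff zero_less_Suc)
  have "\<exists>a\<in>A. sup_norm n (z - a) < inverse (real (Suc k))" for k
    using 0[of k] by (simp only: cINF_less_iff[OF A(2) dist_inf_bdd])
  then obtain a where a: "\<And>k. a k \<in> A" "\<And>k. sup_norm n (z - a k) < inverse (real (Suc k))"
    by metis
  have *: "(\<lambda>k. u k) \<longlonglongrightarrow> l" if "\<And>k. \<bar>l - u k\<bar> \<le> sup_norm n (z - a k)" for u :: "nat \<Rightarrow> real" and l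
  proof -
    have "norm (u k - l) \<le> inverse (real (Suc k))" for k
      using that[of k] a(2)[of k] by (simp add: abs_minus_commute)
    then have "(\<lambda>k. u k - l) \<longlonglongrightarrow> 0"
      by (intro Lim_null_comparison[OF _ LIMSEQ_inverse_real_of_nat]) simp
    then show ?thesis by (rule LIM_zero_cancel)
  qed
  have "(\<lambda>k. fst (a k) i) \<longlonglongrightarrow> fst z i" for i
  proof (cases "i < n")
    case True
    then show ?thesis using sup_norm_ge(2)[OF True, of "z - a _"] by (intro *) simp
  next
    case False
    have "fst (a k) \<in> topspace (Euclidean_space n)" for k using closed_hypo(2)[OF A(1)] a(1) by blast
    then show ?thesis using False z(1) by (simp add: topspace_Euclidean_space)
  qed
  then have "limitin (powertop_real UNIV) (\<lambda>k. fst (a k)) (fst z) sequentially"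
    by (subst limitin_componentwise) simp
  then have "(\<lambda>k. fst (a k)) \<longlonglongrightarrow> fst z"
    by (simp add: euclidean_product_topology)
  moreover have "(\<lambda>k. snd (a k)) \<longlonglongrightarrow> snd z" using sup_norm_ge(1)[of "z - a _" n] by (intro *) simp
  ultimately have "(\<lambda>k. (fst (a k), snd (a k))) \<longlonglongrightarrow> (fst z, snd z)" by (rule tendsto_Pair)
  then have "a \<longlonglongrightarrow> z" by simp
  then show False using closed_sequentially[OF closed_hypo(1)[OF A(1)]] a(1) z(2) by blast
qed

lemma dist_inf_zero: "z \<in> A \<Longrightarrow> dist_inf n z A = 0"
proof -
  assume "z \<in> A"
  moreover have "z - z = origin" by (simp add: prod_eq_iff fun_eq_iff)
  ultimately show ?thesis
    using dist_inf_le[of z A n z] dist_inf_nonneg[of A n z] by (auto simp: sup_norm_0)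
qed

lemma hypo_inject:
  assumes "f \<in> extensional S" "g \<in> extensional S" "hypo S f = hypo S g"
  shows "f = g"
proof (rule extensionalityI[OF assms(1,2)])
  fix x assume "x \<in> S"
  then have "ereal \<alpha> \<le> f x \<longleftrightarrow> ereal \<alpha> \<le> g x" for \<alpha> using assms(3) by (auto simp: hypo_def)
  then show "f x = g x" by (metis ereal_dense2 less_le_not_le linorder_cases linorder_not_le)
qed

lemma aw_dist_nonneg: "(\<lambda>_. 0) \<in> S \<Longrightarrow> 0 \<le> aw_dist n S f g"
  unfolding aw_dist_def set_lebesgue_integral_def
  by (intro integral_nonneg_AE) (auto simp: indicator_def aw_rho_nonneg)

lemma aw_dist_commute: "aw_dist n S f g = aw_dist n S g f"
  by (simp add: aw_dist_def aw_rho_def abs_minus_commute)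

lemma aw_dist_separates:
  assumes S: "closedin (Euclidean_space n) S" "(\<lambda>_. 0) \<in> S"
    and f: "f \<in> usc_fcns n S" and g: "g \<in> usc_fcns n S" and z: "z \<in> hypo S f" "z \<notin> hypo S g"
  shows "0 < aw_dist n S f g"
proof -
  have zS: "z \<in> S \<times> UNIV" using z(1) by (auto simp: hypo_def)
  then have zE: "fst z \<in> topspace (Euclidean_space n)" using closedin_subset[OF S(1)] by auto
  define r where "r = sup_norm n z"
  define \<delta> where "\<delta> = dist_inf n z (hypo S g)"
  have r: "0 \<le> r" by (simp add: r_def sup_norm_nonneg)
  have \<delta>: "0 < \<delta>" unfolding \<delta>_def using g z(2) zE by (intro dist_inf_pos) (auto simp: usc_fcns_def)
  have "aw_gap n S f g z = \<delta>" using \<delta> by (simp add: aw_gap_def \<delta>_def dist_inf_zero[OF z(1)])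
  then have le: "\<delta> \<le> aw_rho n S \<rho> f g" if "r \<le> \<rho>" for \<rho>
    using aw_gap_le_rho[OF zS, of n \<rho> f g] that by (simp add: r_def)
  have "0 < \<delta> * exp (- (r + 1))" using \<delta> by simp
  also have "\<dots> = (\<integral>x. indicator {r..r+1} x *\<^sub>R (\<delta> * exp (- (r + 1))) \<partial>lborel)" by simp
  also have "\<dots> \<le> aw_dist n S f g"
    unfolding aw_dist_def set_lebesgue_integral_def
  proof (rule integral_mono)
    show "integrable lborel (\<lambda>x. indicator {0..} x *\<^sub>R (aw_rho n S x f g * exp (- x)))"
      using aw_integrable[OF S(2)] unfolding set_integrable_def .
    fix x :: real
    have "\<delta> * exp (- (r + 1)) \<le> aw_rho n S x f g * exp (- x)" if "r \<le> x" "x \<le> r + 1"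
      using le[OF that(1)] that \<delta> by (intro mult_mono) auto
    moreover have "0 \<le> aw_rho n S x f g * exp (- x)" if "0 \<le> x"
      using aw_rho_nonneg[OF S(2) that] by simp
    ultimately show "indicator {r..r+1} x *\<^sub>R (\<delta> * exp (- (r + 1)))
        \<le> indicator {0..} x *\<^sub>R (aw_rho n S x f g * exp (- x))"
      using r by (auto simp: indicator_def)
  qed simp
  finally show ?thesis .
qed

lemma Metric_space_aw_dist:
  assumes S: "closedin (Euclidean_space n) S" "(\<lambda>_. 0) \<in> S"
  shows "Metric_space (usc_fcns n S) (aw_dist n S)"
proof
  fix f g h
  show "0 \<le> aw_dist n S f g" using S(2) by (rule aw_dist_nonneg)
  show "aw_dist n S f g = aw_dist n S g f" by (rule aw_dist_commute)
  show "aw_dist n S f g = 0 \<longleftrightarrow> f = g" if fg: "f \<in> usc_fcns n S" "g \<in> usc_fcns n S"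
  proof
    assume 0: "aw_dist n S f g = 0"
    then have 1: "aw_dist n S g f = 0" using aw_dist_commute[of n S] by simp
    have "hypo S f = hypo S g"
      using aw_dist_separates[OF S fg] aw_dist_separates[OF S fg(2,1)] 0 1 by (metis less_irrefl subsetI subset_antisym)
    then show "f = g" using fg by (intro hypo_inject[of _ S]) (auto simp: usc_fcns_def)
  next
    assume "f = g"
    then show "aw_dist n S f g = 0"
    proof -
      have "aw_rho n S \<rho> f f \<le> 0" if "0 \<le> \<rho>" for \<rho>
        unfolding aw_rho_def using ball_ne[OF S(2) that, of n] by (intro cSUP_least) auto
      then have "aw_rho n S \<rho> f f = 0" if "0 \<le> \<rho>" for \<rho>
        using aw_rho_nonneg[OF S(2) that, of n f f] that by (simp add: order_antisym)
      then have "(\<lambda>\<rho>. indicator {0..} \<rho> *\<^sub>R (aw_rho n S \<rho> f f * exp (- \<rho>))) = (\<lambda>_. 0)"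
        by (auto simp: fun_eq_iff indicator_def)
      then show ?thesis using \<open>f = g\<close> by (simp add: aw_dist_def set_lebesgue_integral_def)
    qed
  qed
  have "aw_dist n S f h \<le> (LINT \<rho>:{0..}|lborel. aw_rho n S \<rho> f g * exp (- \<rho>) + aw_rho n S \<rho> g h * exp (- \<rho>))"
    unfolding aw_dist_def
    using aw_rho_triangle[OF S(2), of _ n f h g]
    by (intro set_integral_mono set_integral_add aw_integrable S(2)) (auto simp flip: distrib_right)
  also have "\<dots> = aw_dist n S f g + aw_dist n S g h"
    unfolding aw_dist_def by (intro set_integral_add aw_integrable S(2))
  finally show "aw_dist n S f h \<le> aw_dist n S f g + aw_dist n S g h" .
qed

text \<open>
  Values in \<^typ>\<open>enat\<close>, so that a set without a finite cover has covering number \<open>\<infinity>\<close>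
  instead of a spurious \<open>0\<close>.
\<close>

definition covering_number ::
  "nat \<Rightarrow> (nat \<Rightarrow> real) set \<Rightarrow> ((nat \<Rightarrow> real) \<Rightarrow> ereal) set \<Rightarrow> real \<Rightarrow> enat" where
  "covering_number n S F \<epsilon> =
     (INF C\<in>{C. finite C \<and> C \<subseteq> usc_fcns n S \<and>
                 F \<subseteq> (\<Union>f\<^sub>0\<in>C. Metric_space.mcball (usc_fcns n S) (aw_dist n S) f\<^sub>0 \<epsilon>)}.
        enat (card C))"

end

theory Submission
  imports Defs
begin

text \<open>
  Cut \<open>[-M, M]\<^sup>n\<close> into cells of side \<open>\<delta>\<close> and record, for every cell, the highest multiple of \<open>\<delta>\<close>
  that \<open>f\<close> reaches in it. Functions with the same record have hypographs that are \<open>\<delta>\<close>-close in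
  \<open>[-M, M]\<^sup>n\<^sup>+\<^sup>1\<close>, and as \<open>M\<close> grows like \<open>ln (1 / \<epsilon>)\<close> the weight \<open>exp (- \<rho>)\<close> in the distance makes
  everything outside negligible. The number of records is of order \<open>(M / \<delta>) ^ ((M / \<delta>) ^ n)\<close>.
\<close>

section \<open>Estimates for the Attouch-Wets distance\<close>

lemma exp_half_integral: "(LINT \<rho>:{0..}|lborel. exp (- \<rho> / 2)) = (2::real)"
proof -
  have "filterlim (\<lambda>x::real. - 1 / 2 * x) at_bot at_top"
    by (rule filterlim_tendsto_neg_mult_at_bot[OF tendsto_const _ filterlim_ident]) simp
  then have "((\<lambda>x::real. - 2 * exp (- 1 / 2 * x)) \<longlongrightarrow> - 2 * 0) at_top"
    by (intro tendsto_intros filterlim_compose[OF exp_at_bot])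
  then have "((\<lambda>x::real. - 2 * exp (- x / 2)) \<longlongrightarrow> 0) at_top" by simp
  then have "(\<integral>\<^sup>+x. ennreal (exp (- x / 2)) * indicator {0..} x \<partial>lborel) = ennreal (0 - (- 2 * exp (- 0 / 2)))"
    by (intro nn_integral_FTC_atLeast) (auto intro!: derivative_eq_intros)
  then have "(\<integral>\<^sup>+x. ennreal (indicator {0..} x *\<^sub>R exp (- x / 2)) \<partial>lborel) = ennreal 2"
    by (simp add: ennreal_mult' mult.commute ennreal_indicator)
  then show ?thesis
    unfolding set_lebesgue_integral_def
    by (intro integral_eq_nn_integral[THEN trans]) auto
qed

text \<open>On \<open>[0, 1]\<close> the integrand is at least the gap at the origin times
  \<open>exp (- 1)\<close>. This turns membership in an \<open>aw_dist\<close>-ball into a bound on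
  how far a hypograph lies from the origin.\<close>

lemma aw_gap_origin_le_aw_dist:
  assumes "(\<lambda>_. 0) \<in> S"
  shows "aw_gap n S f g origin \<le> exp 1 * aw_dist n S f g"
proof -
  let ?\<delta> = "aw_gap n S f g origin"
  have \<delta>: "0 \<le> ?\<delta>" by (simp add: aw_gap_def)
  have le: "?\<delta> \<le> aw_rho n S \<rho> f g" if "0 \<le> \<rho>" for \<rho>
    by (rule aw_gap_le_rho) (use assms that in \<open>auto simp: sup_norm_0\<close>)
  have "?\<delta> * exp (- 1) = (\<integral>x. indicator {0..1::real} x *\<^sub>R (?\<delta> * exp (- 1)) \<partial>lborel)"
    by simp
  also have "\<dots> \<le> aw_dist n S f g"
    unfolding aw_dist_def set_lebesgue_integral_def
  proof (rule integral_mono)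
    show "integrable lborel (\<lambda>x. indicator {0..} x *\<^sub>R (aw_rho n S x f g * exp (- x)))"
      using aw_integrable[OF assms] unfolding set_integrable_def .
    fix x :: real
    have "?\<delta> * exp (- 1) \<le> aw_rho n S x f g * exp (- x)" if "0 \<le> x" "x \<le> 1"
      using le[OF that(1)] that \<delta> by (intro mult_mono) auto
    moreover have "0 \<le> aw_rho n S x f g * exp (- x)" if "0 \<le> x"
      using aw_rho_nonneg[OF assms that] by simp
    ultimately show "indicator {0..1} x *\<^sub>R (?\<delta> * exp (- 1))
        \<le> indicator {0..} x *\<^sub>R (aw_rho n S x f g * exp (- x))"
      by (auto simp: indicator_def)
  qed simp
  finally show ?thesis
    by (simp add: exp_minus field_simps)
qed

text \<open>The integral is split at \<rho>. Up to \<rho>, monotonicity in the radius gives \<eta>.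
  Beyond it, the growth \<open>K + 2 * x\<close> costs a factor \<open>exp (x / 4)\<close>, and a
  further \<open>exp (- x / 4)\<close> makes the tail small. Both pieces lie below
  \<open>\<eta> * exp (- x / 2)\<close>, whose integral is \<open>2 * \<eta>\<close>.\<close>

lemma aw_dist_le:
  assumes S: "(\<lambda>_. 0) \<in> S" and K: "0 \<le> K" "aw_gap n S f g origin \<le> K"
    and close: "aw_rho n S \<rho> f g \<le> \<eta>" and \<eta>: "(K + 8) * exp (- \<rho> / 4) \<le> \<eta>"
  shows "aw_dist n S f g \<le> 2 * \<eta>"
proof -
  have "aw_rho n S x f g * exp (- x) \<le> \<eta> * exp (- x / 2)" if x: "0 \<le> x" for x
  proof (cases "x \<le> \<rho>")
    case True
    have "aw_rho n S x f g \<le> \<eta>" using aw_rho_mono[OF S x True] close by (rule order_trans)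
    then show ?thesis
      using x aw_rho_nonneg[OF S x, of n f g] by (intro mult_mono) auto
  next
    case False
    have "aw_rho n S x f g \<le> K + 2 * x" using aw_rho_le[OF S x, of n f g] K by linarith
    also have "\<dots> \<le> (K + 8) * exp (x / 4)"
    proof -
      have "K * 1 \<le> K * exp (x / 4)" by (intro mult_left_mono) (use K x in auto)
      \<comment> \<open>Multiplied by 8 this bounds \<open>2 * x\<close>; hence the 8 in
        \<open>K + 8\<close>.\<close>
      moreover have "1 + x / 4 \<le> exp (x / 4)" by (rule exp_ge_add_one_self)
      ultimately have "K + 2 * x \<le> K * exp (x / 4) + 8 * exp (x / 4)" by linarith
      then show ?thesis by (simp add: algebra_simps)
    qed
    finally have "aw_rho n S x f g * exp (- x) \<le> (K + 8) * exp (x / 4) * exp (- x)"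
      by (rule mult_right_mono) simp
    also have "\<dots> = (K + 8) * exp (- x / 4) * exp (- x / 2)"
      by (simp add: mult.assoc flip: exp_add)
    also have "\<dots> \<le> \<eta> * exp (- x / 2)"
    proof (rule mult_right_mono)
      have "(K + 8) * exp (- x / 4) \<le> (K + 8) * exp (- \<rho> / 4)"
        using False K by (intro mult_left_mono) auto
      then show "(K + 8) * exp (- x / 4) \<le> \<eta>" using \<eta> by linarith
    qed simp
    finally show ?thesis .
  qed
  then have "aw_dist n S f g \<le> (LINT x:{0..}|lborel. \<eta> * exp (- x / 2))"
    unfolding aw_dist_def
    by (intro set_integral_mono aw_integrable S set_integrable_mult_right exp_half_integrable) auto
  also have "\<dots> = 2 * \<eta>" by (simp only: set_integral_mult_right exp_half_integral mult.commute)
  finally show ?thesis .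
qed

text \<open>One half of the comparison of distances. A near-minimiser of the distance from
  \<open>z\<close> to \<open>A\<close> has norm at most \<open>2 * \<rho> + K + 1\<close>: \<rho>
  for \<open>z\<close>, \<open>\<rho> + K\<close> for the distance to \<open>A\<close>, and 1 for
  slack. So it suffices to approximate \<open>A\<close> inside that ball.\<close>

lemma dist_inf_le_add:
  assumes A: "A \<noteq> {}" "dist_inf n origin A \<le> K" and z: "sup_norm n z \<le> \<rho>"
    and near: "\<And>a. a \<in> A \<Longrightarrow> sup_norm n a \<le> 2 * \<rho> + K + 1 \<Longrightarrow> \<exists>b\<in>B. sup_norm n (a - b) \<le> \<delta>"
  shows "dist_inf n z B \<le> dist_inf n z A + \<delta>"
proof (rule field_le_epsilon)
  fix e :: real assume e: "0 < e"
  have z0: "w - origin = w" for w :: "(nat \<Rightarrow> real) \<times> real" by (simp add: prod_eq_iff fun_eq_iff)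
  \<comment> \<open>The slack is capped at 1 to keep \<open>a\<close> in the ball even when
    \<open>e\<close> is large.\<close>
  have "dist_inf n z A < dist_inf n z A + min e 1" using e by simp
  then have "\<exists>a\<in>A. sup_norm n (z - a) < dist_inf n z A + min e 1"
    unfolding dist_inf_def[of n z A] by (simp only: cINF_less_iff[OF A(1) dist_inf_bdd])
  then obtain a where a: "a \<in> A" "sup_norm n (z - a) < dist_inf n z A + min e 1" by blast
  have "dist_inf n z A \<le> \<rho> + K"
    using dist_inf_Lipschitz[of n z A origin] A(2) z by (simp add: z0)
  moreover have "sup_norm n a \<le> sup_norm n (z - a) + sup_norm n z"
    using sup_norm_triangle[of n a origin z] by (simp add: z0 sup_norm_commute)
  ultimately have "sup_norm n a \<le> 2 * \<rho> + K + 1" using a(2) z by linarith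
  from near[OF a(1) this] obtain b where b: "b \<in> B" "sup_norm n (a - b) \<le> \<delta>" by blast
  have "dist_inf n z B \<le> sup_norm n (z - b)" by (rule dist_inf_le[OF b(1)])
  also have "\<dots> \<le> sup_norm n (z - a) + sup_norm n (a - b)" by (rule sup_norm_triangle)
  also have "\<dots> \<le> dist_inf n z A + e + \<delta>" using a(2) b(2) by linarith
  finally show "dist_inf n z B \<le> dist_inf n z A + \<delta> + e" by simp
qed

section \<open>Discretising hypographs on a grid\<close>

definition cell :: "nat \<Rightarrow> real \<Rightarrow> real \<Rightarrow> (nat \<Rightarrow> real) \<Rightarrow> nat \<Rightarrow> int" where
  "cell n M \<delta> x = restrict (\<lambda>i. \<lfloor>(x i + M) / \<delta>\<rfloor>) {..<n}"

definition cells :: "nat \<Rightarrow> nat \<Rightarrow> (nat \<Rightarrow> int) set" where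
  "cells n m = (\<Pi>\<^sub>E i\<in>{..<n}. {0..int m})"

text \<open>Asking for a point of the cell that reaches a given height avoids the supremum of
  \<open>f\<close>, which may be infinite or not attained.\<close>

definition levels ::
  "nat \<Rightarrow> (nat \<Rightarrow> real) set \<Rightarrow> real \<Rightarrow> real \<Rightarrow> nat \<Rightarrow> ((nat \<Rightarrow> real) \<Rightarrow> ereal) \<Rightarrow> (nat \<Rightarrow> int) \<Rightarrow> nat set" where
  "levels n S M \<delta> m f q = {j. j \<le> m \<and> (\<exists>x\<in>S. cell n M \<delta> x = q \<and> ereal (real j * \<delta> - M) \<le> f x)}"

text \<open>For positive \<delta> the levels form an initial segment of the naturals, so their
  number determines them. The count 0 stands for cells where no level is reached, in particular
  those missing \<open>S\<close>.\<close>

definition signature ::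
  "nat \<Rightarrow> (nat \<Rightarrow> real) set \<Rightarrow> real \<Rightarrow> real \<Rightarrow> nat \<Rightarrow> ((nat \<Rightarrow> real) \<Rightarrow> ereal) \<Rightarrow> (nat \<Rightarrow> int) \<Rightarrow> nat" where
  "signature n S M \<delta> m f = restrict (\<lambda>q. card (levels n S M \<delta> m f q)) (cells n m)"

lemma card_cells: "card (cells n m) = (m + 1) ^ n"
  by (simp add: cells_def card_PiE nat_add_distrib)

lemma finite_cells: "finite (cells n m)"
  by (simp add: cells_def finite_PiE)

lemma signature_in: "signature n S M \<delta> m f \<in> (\<Pi>\<^sub>E q\<in>cells n m. {..m + 1})"
proof -
  have "card (levels n S M \<delta> m f q) \<le> card {..m}" for q
    by (rule card_mono) (auto simp: levels_def)
  then show ?thesis by (auto simp: signature_def PiE_iff)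
qed

lemma finite_levels: "finite (levels n S M \<delta> m f q)"
  by (rule finite_subset[of _ "{..m}"]) (auto simp: levels_def)

lemma levels_downward:
  assumes "0 < \<delta>" "j \<in> levels n S M \<delta> m f q" "i \<le> j"
  shows "i \<in> levels n S M \<delta> m f q"
proof -
  obtain x where x: "x \<in> S" "cell n M \<delta> x = q" "ereal (real j * \<delta> - M) \<le> f x" "j \<le> m"
    using assms(2) by (auto simp: levels_def)
  have "ereal (real i * \<delta> - M) \<le> ereal (real j * \<delta> - M)"
    using assms by (simp add: mult_right_mono)
  then have "ereal (real i * \<delta> - M) \<le> f x" using x(3) by (rule order_trans)
  then show ?thesis using x assms(3) by (auto simp: levels_def)
qed

text \<open>Both sets are downward closed, hence nested, and nested finite sets of equal size
  coincide.\<close>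

lemma levels_eq:
  assumes "0 < \<delta>" "signature n S M \<delta> m f = signature n S M \<delta> m g" "q \<in> cells n m"
  shows "levels n S M \<delta> m f q = levels n S M \<delta> m g q"
proof -
  let ?A = "levels n S M \<delta> m f q" and ?B = "levels n S M \<delta> m g q"
  have c: "card ?A = card ?B"
    using fun_cong[OF assms(2), of q] assms(3) by (simp add: signature_def)
  have "?A \<subseteq> ?B \<or> ?B \<subseteq> ?A"
    using levels_downward[OF assms(1)] by (meson linear subsetI)
  then show ?thesis using c finite_levels by (metis card_subset_eq)
qed

lemma abs_diff_less_of_floor_eq:
  fixes x y M \<delta> :: real
  assumes "0 < \<delta>" "\<lfloor>(x + M) / \<delta>\<rfloor> = \<lfloor>(y + M) / \<delta>\<rfloor>"
  shows "\<bar>x - y\<bar> < \<delta>"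
proof -
  have "\<bar>(x + M) / \<delta> - (y + M) / \<delta>\<bar> < 1" using assms(2) by linarith
  then have "\<bar>x - y\<bar> / \<delta> < 1"
    using assms(1) by (simp add: abs_divide flip: diff_divide_distrib)
  then show ?thesis using assms(1) by simp
qed

text \<open>The height of \<open>a\<close> is rounded down to the grid. The result is a level of
  \<open>f\<close> in the cell of \<open>a\<close>, hence also of \<open>g\<close>, reached at some
  \<open>y\<close> of the same cell. Rounding and the change of point each cost less than \<delta>
  per coordinate.\<close>

lemma hypo_close_of_signature_eq:
  assumes \<delta>: "0 < \<delta>" and M: "0 \<le> M" and m: "m = nat \<lfloor>2 * M / \<delta>\<rfloor>"
    and eq: "signature n S M \<delta> m f = signature n S M \<delta> m g"
    and a: "a \<in> hypo S f" "sup_norm n a \<le> M"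
  shows "\<exists>b\<in>hypo S g. sup_norm n (a - b) \<le> \<delta>"
proof -
  obtain x \<alpha> where x: "a = (x, \<alpha>)" "x \<in> S" "ereal \<alpha> \<le> f x" using a(1) by (auto simp: hypo_def)
  have bd: "\<bar>\<alpha>\<bar> \<le> M" "\<And>i. i < n \<Longrightarrow> \<bar>x i\<bar> \<le> M" using a(2) x(1) by (auto simp: sup_norm_le_iff)
  \<comment> \<open>The endpoint \<open>t = M\<close> has index exactly \<open>m\<close>, so each
    axis carries \<open>m + 1\<close> indices.\<close>
  have fl: "0 \<le> \<lfloor>(t + M) / \<delta>\<rfloor>" "\<lfloor>(t + M) / \<delta>\<rfloor> \<le> int m" if "\<bar>t\<bar> \<le> M" for t
  proof -
    show "0 \<le> \<lfloor>(t + M) / \<delta>\<rfloor>" using that \<delta> by simp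
    have "(t + M) / \<delta> \<le> 2 * M / \<delta>" using that \<delta> by (intro divide_right_mono) auto
    then show "\<lfloor>(t + M) / \<delta>\<rfloor> \<le> int m" unfolding m by (simp add: floor_mono le_nat_iff)
  qed
  define q where "q = cell n M \<delta> x"
  have q: "q \<in> cells n m" using fl bd(2) by (auto simp: q_def cell_def cells_def PiE_iff)
  define j where "j = nat \<lfloor>(\<alpha> + M) / \<delta>\<rfloor>"
  have j: "j \<le> m" using fl[OF bd(1)] by (simp add: j_def)
  have "real j = of_int \<lfloor>(\<alpha> + M) / \<delta>\<rfloor>" using fl(1)[OF bd(1)] by (simp add: j_def)
  then have "real j \<le> (\<alpha> + M) / \<delta>" "(\<alpha> + M) / \<delta> < real j + 1" by linarith+
  then have ja: "real j * \<delta> - M \<le> \<alpha>" "\<alpha> < real j * \<delta> - M + \<delta>"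
    using \<delta> by (simp_all add: field_simps)
  have "ereal (real j * \<delta> - M) \<le> f x" using ja(1) x(3) by (meson ereal_less_eq(3) order_trans)
  then have "j \<in> levels n S M \<delta> m f q" using j x(2) by (auto simp: levels_def q_def)
  then have "j \<in> levels n S M \<delta> m g q" using levels_eq[OF \<delta> eq q] by simp
  then obtain y where y: "y \<in> S" "cell n M \<delta> y = q" "ereal (real j * \<delta> - M) \<le> g y"
    by (auto simp: levels_def)
  have "\<bar>x i - y i\<bar> \<le> \<delta>" if "i < n" for i
  proof -
    have "\<lfloor>(x i + M) / \<delta>\<rfloor> = \<lfloor>(y i + M) / \<delta>\<rfloor>"
      using fun_cong[OF y(2), of i] that by (simp add: q_def cell_def)
    then show ?thesis using abs_diff_less_of_floor_eq[OF \<delta>] by fastforce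
  qed
  then have "sup_norm n (a - (y, real j * \<delta> - M)) \<le> \<delta>"
    using ja x(1) by (simp add: sup_norm_le_iff)
  moreover have "(y, real j * \<delta> - M) \<in> hypo S g" using y by (simp add: hypo_def)
  ultimately show ?thesis by blast
qed

text \<open>\<open>M\<close> is the radius that \<open>dist_inf_le_add\<close> demands, so closeness
  of the hypographs up to \<open>M\<close>, used in both directions, controls the distance functions
  on the ball of radius \<rho>.\<close>

lemma aw_rho_le_of_signature_eq:
  assumes S: "(\<lambda>_. 0) \<in> S" and \<rho>: "0 \<le> \<rho>" and K: "0 \<le> K" and \<delta>: "0 < \<delta>"
    and M: "M = 2 * \<rho> + K + 1" and m: "m = nat \<lfloor>2 * M / \<delta>\<rfloor>"
    and f: "hypo S f \<noteq> {}" "dist_inf n origin (hypo S f) \<le> K"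
    and g: "hypo S g \<noteq> {}" "dist_inf n origin (hypo S g) \<le> K"
    and eq: "signature n S M \<delta> m f = signature n S M \<delta> m g"
  shows "aw_rho n S \<rho> f g \<le> \<delta>"
  unfolding aw_rho_def
proof (rule cSUP_least)
  show "{z \<in> S \<times> UNIV. sup_norm n z \<le> \<rho>} \<noteq> {}" using ball_ne[OF S \<rho>] by blast
  fix z assume "z \<in> {z \<in> S \<times> UNIV. sup_norm n z \<le> \<rho>}"
  then have z: "sup_norm n z \<le> \<rho>" by simp
  have M0: "0 \<le> M" using M \<rho> K by simp
  have "dist_inf n z (hypo S g) \<le> dist_inf n z (hypo S f) + \<delta>"
    by (rule dist_inf_le_add[OF f z], rule hypo_close_of_signature_eq[OF \<delta> M0 m eq]) (use M in auto)
  moreover have "dist_inf n z (hypo S f) \<le> dist_inf n z (hypo S g) + \<delta>"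
    by (rule dist_inf_le_add[OF g z], rule hypo_close_of_signature_eq[OF \<delta> M0 m eq[symmetric]]) (use M in auto)
  ultimately show "\<bar>dist_inf n z (hypo S f) - dist_inf n z (hypo S g)\<bar> \<le> \<delta>" by linarith
qed

section \<open>Covering numbers from signature counts\<close>

text \<open>
  The centres are representatives in \<open>F\<close> of the fibres of \<open>s\<close>, so no usc function has to be
  built from a signature.
\<close>
lemma covering_number_le_card:
  assumes S: "closedin (Euclidean_space n) S" "(\<lambda>_. 0) \<in> S"
    and F: "F \<subseteq> usc_fcns n S" and T: "finite T" "s ` F \<subseteq> T"
    and close: "\<And>f g. f \<in> F \<Longrightarrow> g \<in> F \<Longrightarrow> s f = s g \<Longrightarrow> aw_dist n S f g \<le> \<epsilon>"
  shows "\<exists>N. covering_number n S F \<epsilon> = enat N \<and> N \<le> card T"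
proof -
  interpret Metric_space "usc_fcns n S" "aw_dist n S" by (rule Metric_space_aw_dist[OF S])
  define C where "C = inv_into F s ` (s ` F)"
  have fin: "finite (s ` F)" using T finite_subset by blast
  have CF: "C \<subseteq> F" by (auto simp: C_def inv_into_into)
  have "f \<in> (\<Union>f\<^sub>0\<in>C. mcball f\<^sub>0 \<epsilon>)" if f: "f \<in> F" for f
  proof -
    let ?h = "inv_into F s (s f)"
    have "?h \<in> C" using f by (auto simp: C_def)
    moreover have "aw_dist n S ?h f \<le> \<epsilon>"
      using f by (intro close) (auto simp: inv_into_into f_inv_into_f)
    ultimately show ?thesis using CF F f by auto
  qed
  then have "covering_number n S F \<epsilon> \<le> enat (card C)"
    unfolding covering_number_def using fin CF F by (intro INF_lower) (auto simp: C_def)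
  moreover have "card C \<le> card T"
    unfolding C_def using card_image_le[OF fin] card_mono[OF T] order_trans by blast
  ultimately show ?thesis 
    by (cases "covering_number n S F \<epsilon>") auto
qed

text \<open>Signatures map \<open>(m + 1) ^ n\<close> cells to the \<open>m + 2\<close> values from
  0 to \<open>m + 1\<close>. The radius \<open>2 * \<delta>\<close> is the one delivered by
  \<open>aw_dist_le\<close>.\<close>

lemma covering_number_le_signatures:
  assumes S: "closedin (Euclidean_space n) S" "(\<lambda>_. 0) \<in> S"
    and F: "F \<subseteq> usc_fcns n S" "\<And>f. f \<in> F \<Longrightarrow> dist_inf n origin (hypo S f) \<le> K"
    and K: "0 \<le> K" and \<rho>: "0 \<le> \<rho>" and \<delta>: "0 < \<delta>" "(K + 8) * exp (- \<rho> / 4) \<le> \<delta>"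
    and m: "m = nat \<lfloor>2 * (2 * \<rho> + K + 1) / \<delta>\<rfloor>"
  shows "\<exists>N. covering_number n S F (2 * \<delta>) = enat N \<and> N \<le> (m + 2) ^ ((m + 1) ^ n)"
proof -
  define M where "M = 2 * \<rho> + K + 1"
  define T where "T = (\<Pi>\<^sub>E q\<in>cells n m. {..m + 1})"
  have "\<exists>N. covering_number n S F (2 * \<delta>) = enat N \<and> N \<le> card T"
  proof (rule covering_number_le_card[OF S F(1), where s = "signature n S M \<delta> m"])
    show "finite T" unfolding T_def using finite_cells by (intro finite_PiE) auto
    show "signature n S M \<delta> m ` F \<subseteq> T" unfolding T_def using signature_in by (rule image_subsetI)
    fix f g assume fg: "f \<in> F" "g \<in> F" and eq: "signature n S M \<delta> m f = signature n S M \<delta> m g"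
    have ne: "hypo S f \<noteq> {}" "hypo S g \<noteq> {}" using fg F(1) by (auto simp: usc_fcns_def)
    have "aw_rho n S \<rho> f g \<le> \<delta>"
      by (rule aw_rho_le_of_signature_eq[OF S(2) \<rho> K \<delta>(1) M_def _ ne(1) F(2)[OF fg(1)] ne(2) F(2)[OF fg(2)] eq])
         (simp add: m M_def)
    \<comment> \<open>Both distances lie in \<open>[0, K]\<close>, so their difference costs
      \<open>K\<close> and not \<open>2 * K\<close>.\<close>
    moreover have "aw_gap n S f g origin \<le> K"
      unfolding aw_gap_def
      using F(2)[OF fg(1)] F(2)[OF fg(2)] dist_inf_nonneg[OF ne(1), of n origin]
        dist_inf_nonneg[OF ne(2), of n origin] by linarith
    ultimately show "aw_dist n S f g \<le> 2 * \<delta>"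
      using aw_dist_le[OF S(2) K] \<delta>(2) by blast
  qed
  moreover have "card T = (m + 2) ^ ((m + 1) ^ n)"
    by (simp add: T_def card_PiE finite_cells card_cells)
  ultimately show ?thesis by simp
qed

section \<open>Explicit constants\<close>

text \<open>With \<open>L = ln (1 / \<epsilon>)\<close>, the bound \<open>K + 1 \<le> L\<close>
  absorbs \<open>K\<close>, so that \<open>m \<le> 68 * (L / \<epsilon>)\<close> and
  \<open>ln (m + 2) \<le> 3 * L\<close>. The base 207 is \<open>69 * 3\<close>.\<close>

lemma signature_count_bound:
  fixes \<epsilon> K :: real
  assumes n: "1 \<le> n" and K: "0 \<le> K" and \<epsilon>: "0 < \<epsilon>" "\<epsilon> \<le> exp (- (K + 1))" "\<epsilon> \<le> 1 / 70"
    and m: "m = nat \<lfloor>2 * (2 * (8 * ln (1 / \<epsilon>)) + K + 1) / (\<epsilon> / 2)\<rfloor>"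
  shows "ln (real ((m + 2) ^ ((m + 1) ^ n))) \<le> (207 / \<epsilon>) ^ n * ln (1 / \<epsilon>) ^ (n + 1)"
proof -
  define L where "L = ln (1 / \<epsilon>)"
  have "ln \<epsilon> \<le> - (K + 1)" using ln_le_cancel_iff[of \<epsilon> "exp (- (K + 1))"] \<epsilon> by simp
  then have L: "K + 1 \<le> L" using \<epsilon> by (simp add: L_def ln_div)
  have L_le: "L \<le> 1 / \<epsilon>" unfolding L_def using \<epsilon> ln_le_minus_one[of "1 / \<epsilon>"] by simp
  have Le: "1 \<le> L / \<epsilon>" using L K \<epsilon> by (simp add: field_simps)
  have "real m \<le> 2 * (16 * L + K + 1) / (\<epsilon> / 2)"
    unfolding m L_def[symmetric] using L K \<epsilon> by simp
  also have "\<dots> \<le> 2 * (17 * L) / (\<epsilon> / 2)"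
    using L \<epsilon> by (intro divide_right_mono) auto
  also have "\<dots> = 68 * (L / \<epsilon>)" by simp
  finally have m_le: "real m \<le> 68 * (L / \<epsilon>)" .
  have "real m + 2 \<le> 70 * (L / \<epsilon>)" using m_le Le by linarith
  \<comment> \<open>The crude bounds \<open>70 \<le> 1 / \<epsilon>\<close> and
    \<open>L \<le> 1 / \<epsilon>\<close> leave a pure power of \<open>1 / \<epsilon>\<close>, whose
    logarithm is a multiple of \<open>L\<close>.\<close>
  also have "\<dots> \<le> (1 / \<epsilon>) * ((1 / \<epsilon>) / \<epsilon>)"
    using \<epsilon> L_le L K by (intro mult_mono divide_right_mono) (auto simp: field_simps)
  also have "\<dots> = (1 / \<epsilon>) ^ 3" by (simp add: power3_eq_cube)
  finally have "ln (real m + 2) \<le> ln ((1 / \<epsilon>) ^ 3)" using \<epsilon> by (intro ln_mono) auto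
  also have "\<dots> = 3 * L" using \<epsilon> by (simp add: L_def ln_realpow)
  finally have ln_le: "ln (real m + 2) \<le> 3 * L" .
  have "ln (real ((m + 2) ^ ((m + 1) ^ n))) = (real m + 1) ^ n * ln (real m + 2)"
    by (simp add: ln_realpow add.commute)
  also have "\<dots> \<le> (69 * (L / \<epsilon>)) ^ n * (3 * L)"
    using m_le Le ln_le by (intro mult_mono power_mono) auto
  \<comment> \<open>The assumption \<open>1 \<le> n\<close> enters here: at \<open>n = 0\<close> the
    power \<open>3 ^ n\<close> could not absorb the factor 3.\<close>
  also have "\<dots> \<le> (69 * (L / \<epsilon>)) ^ n * (3 ^ n * L)"
    using n L K Le self_le_power[of "3::real" n] by (intro mult_left_mono mult_right_mono) auto
  also have "\<dots> = (207 / \<epsilon>) ^ n * L ^ (n + 1)"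
  proof -
    have "69 * (L / \<epsilon>) * 3 = 207 / \<epsilon> * L" by simp
    then have "(69 * (L / \<epsilon>)) ^ n * 3 ^ n = (207 / \<epsilon>) ^ n * L ^ n"
      by (metis power_mult_distrib)
    then show ?thesis by simp
  qed
  finally show ?thesis by (simp add: L_def)
qed

text \<open>The three terms serve, in order, to give \<open>K + 1 \<le> ln (1 / \<epsilon>)\<close>,
  to absorb the constant 70, and to make the tail beyond \<rho> at most
  \<open>\<epsilon> / 2\<close>. None involves the dimension.\<close>

definition radius_bound :: "real \<Rightarrow> real" where
  "radius_bound K = min (exp (- (K + 1))) (min (1 / 70) (1 / (2 * (K + 8))))"

lemma radius_bound_pos: "0 \<le> K \<Longrightarrow> 0 < radius_bound K"
  by (simp add: radius_bound_def)

lemma covering_number_bound: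
  assumes K: "0 \<le> K" and n: "1 \<le> n"
    and S: "closedin (Euclidean_space n) S" "(\<lambda>_. 0) \<in> S"
    and F: "F \<subseteq> usc_fcns n S" "\<And>f. f \<in> F \<Longrightarrow> dist_inf n origin (hypo S f) \<le> K"
    and e: "0 < \<epsilon>" "\<epsilon> \<le> radius_bound K"
  shows "\<exists>N. covering_number n S F \<epsilon> = enat N \<and>
             ln (real N) \<le> (207 / \<epsilon>) ^ n * (ln (1 / \<epsilon>)) ^ (n + 1)"
proof -
  have \<epsilon>: "0 < \<epsilon>" "\<epsilon> \<le> exp (- (K + 1))" "\<epsilon> \<le> 1 / 70" "\<epsilon> \<le> 1 / (2 * (K + 8))"
    using e by (auto simp: radius_bound_def)
  \<comment> \<open>This makes \<open>exp (- \<rho> / 4)\<close> equal to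
    \<open>\<epsilon> * \<epsilon>\<close>; one factor \<epsilon> pays for \<open>K + 8\<close>,
    while \<rho> stays logarithmic in \<open>1 / \<epsilon>\<close>.\<close>
  define \<rho> where "\<rho> = 8 * ln (1 / \<epsilon>)"
  define m where "m = nat \<lfloor>2 * (2 * \<rho> + K + 1) / (\<epsilon> / 2)\<rfloor>"
  have L: "0 \<le> ln (1 / \<epsilon>)" using \<epsilon> by simp
  have "exp (- \<rho> / 4) = exp (ln (\<epsilon>\<^sup>2))"
    using \<epsilon> by (simp add: \<rho>_def ln_div ln_realpow)
  also have "\<dots> = \<epsilon> * \<epsilon>" using \<epsilon> by (simp add: power2_eq_square)
  finally have "(K + 8) * exp (- \<rho> / 4) = (K + 8) * \<epsilon> * \<epsilon>" by simp
  also have "\<dots> \<le> 1 / 2 * \<epsilon>"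
    using \<epsilon> K by (intro mult_right_mono) (auto simp: field_simps)
  finally have tail: "(K + 8) * exp (- \<rho> / 4) \<le> \<epsilon> / 2" by simp
  have "\<exists>N. covering_number n S F (2 * (\<epsilon> / 2)) = enat N \<and> N \<le> (m + 2) ^ ((m + 1) ^ n)"
    by (rule covering_number_le_signatures[OF S F K _ _ tail m_def])
       (use \<epsilon> L in \<open>auto simp: \<rho>_def\<close>)
  then obtain N where N: "covering_number n S F \<epsilon> = enat N" "N \<le> (m + 2) ^ ((m + 1) ^ n)" by auto
  have "ln (real N) \<le> (207 / \<epsilon>) ^ n * (ln (1 / \<epsilon>)) ^ (n + 1)"
  \<comment> \<open>This case arises for empty \<open>F\<close>. Monotonicity of \<open>ln\<close>
    needs a positive argument, but \<open>ln 0 = 0\<close> and the right-hand side is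
    nonnegative.\<close>
  proof (cases "N = 0")
    case True
    then show ?thesis using L \<epsilon> by simp
  next
    case False
    then have "ln (real N) \<le> ln (real ((m + 2) ^ ((m + 1) ^ n)))"
      using N(2) by (intro ln_mono) (simp_all only: of_nat_le_iff of_nat_0_less_iff)
    also have "\<dots> \<le> (207 / \<epsilon>) ^ n * (ln (1 / \<epsilon>)) ^ (n + 1)"
      by (rule signature_count_bound[OF n K \<epsilon>(1-3)]) (simp add: m_def \<rho>_def)
    finally show ?thesis .
  qed
  with N(1) show "\<exists>N. covering_number n S F \<epsilon> = enat N \<and>
      ln (real N) \<le> (207 / \<epsilon>) ^ n * (ln (1 / \<epsilon>)) ^ (n + 1)" by blast
qed

section \<open>Bounded sets and independence of the dimension\<close>

lemma dist_inf_origin_mcball: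
  assumes S: "closedin (Euclidean_space n) S" "(\<lambda>_. 0) \<in> S"
    and f: "f \<in> Metric_space.mcball (usc_fcns n S) (aw_dist n S) h R"
  shows "f \<in> usc_fcns n S" "dist_inf n origin (hypo S f) \<le> dist_inf n origin (hypo S h) + exp 1 * R"
proof -
  interpret Metric_space "usc_fcns n S" "aw_dist n S" by (rule Metric_space_aw_dist[OF S])
  show "f \<in> usc_fcns n S" using f by simp
  have "exp 1 * aw_dist n S h f \<le> exp 1 * R" using f by simp
  then show "dist_inf n origin (hypo S f) \<le> dist_inf n origin (hypo S h) + exp 1 * R"
    using aw_gap_origin_le_aw_dist[OF S(2), of n h f] unfolding aw_gap_def by linarith
qed

lemma covering_number_mbounded:
  assumes n: "1 \<le> n" and S: "closedin (Euclidean_space n) S" "(\<lambda>_. 0) \<in> S"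
    and F: "Metric_space.mbounded (usc_fcns n S) (aw_dist n S) F"
  shows "\<exists>\<epsilon>0>0. \<forall>\<epsilon>. 0 < \<epsilon> \<and> \<epsilon> \<le> \<epsilon>0 \<longrightarrow> (\<exists>N. covering_number n S F \<epsilon> = enat N \<and>
      ln (real N) \<le> (207 / \<epsilon>) ^ n * (ln (1 / \<epsilon>)) ^ (n + 1))"
proof -
  obtain h R where h: "F \<subseteq> Metric_space.mcball (usc_fcns n S) (aw_dist n S) h R"
    using F unfolding Metric_space.mbounded_def[OF Metric_space_aw_dist[OF S]] by blast
  \<comment> \<open>The maximum keeps \<open>K\<close> nonnegative even for negative
    \<open>R\<close>, when the ball is empty.\<close>
  define K where "K = max 0 (dist_inf n origin (hypo S h) + exp 1 * R)"
  have F': "F \<subseteq> usc_fcns n S" "\<And>f. f \<in> F \<Longrightarrow> dist_inf n origin (hypo S f) \<le> K"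
    using dist_inf_origin_mcball[OF S] h by (fastforce simp: K_def)+
  have K: "0 \<le> K" by (simp add: K_def)
  show ?thesis
    using covering_number_bound[OF K n S F'] radius_bound_pos[OF K] by blast
qed

text \<open>The hypograph of the zero function contains the origin, so the contribution of the
  centre vanishes and the admissible \<epsilon> depend on \<open>R\<close> alone.\<close>

lemma covering_number_mcball_zero:
  assumes n: "1 \<le> n" and S: "closedin (Euclidean_space n) S" "(\<lambda>_. 0) \<in> S"
    and F: "F \<subseteq> Metric_space.mcball (usc_fcns n S) (aw_dist n S) (restrict (\<lambda>_. 0) S) R"
    and \<epsilon>: "0 < \<epsilon>" "\<epsilon> \<le> radius_bound (max 0 (exp 1 * R))"
  shows "\<exists>N. covering_number n S F \<epsilon> = enat N \<and>
             ln (real N) \<le> (207 / \<epsilon>) ^ n * (ln (1 / \<epsilon>)) ^ (n + 1)"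
proof (rule covering_number_bound[OF _ n S _ _ \<epsilon>])
  have "origin \<in> hypo S (restrict (\<lambda>_. 0) S)" using S(2) by (simp add: hypo_def zero_ereal_def)
  then have 0: "dist_inf n origin (hypo S (restrict (\<lambda>_. 0) S)) = 0" by (rule dist_inf_zero)
  show "F \<subseteq> usc_fcns n S" using dist_inf_origin_mcball(1)[OF S] F by blast
  show "dist_inf n origin (hypo S f) \<le> max 0 (exp 1 * R)" if "f \<in> F" for f
    using dist_inf_origin_mcball(2)[OF S subsetD[OF F that]] 0 by simp
qed simp

text \<open>A single \<open>F\<close> fixes its dimension, so independence of \<open>n\<close> has
  content only for families of sets. The second conjunct therefore picks the constants from
  \<open>R\<close> before \<open>n\<close>, \<open>S\<close> and \<open>F\<close>. The zero function
  is a centre available in every dimension, and every bounded set lies in some ball around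
  it.\<close>

theorem theorem4p3:
  shows
    "(\<forall>n\<ge>1. \<forall>S F. closedin (Euclidean_space n) S \<and> (\<lambda>_. 0) \<in> S \<and>
        Metric_space.mbounded (usc_fcns n S) (aw_dist n S) F \<longrightarrow>
        (\<exists>c\<ge>0. \<exists>\<epsilon>0>0. \<forall>\<epsilon>. 0 < \<epsilon> \<and> \<epsilon> \<le> \<epsilon>0 \<longrightarrow>
          (\<exists>N. covering_number n S F \<epsilon> = enat N \<and>
               ln (real N) \<le> (c / \<epsilon>) ^ n * (ln (1 / \<epsilon>)) ^ (n + 1)))) \<and>
     (\<forall>R::real. \<exists>c\<ge>0. \<exists>\<epsilon>0>0. \<forall>n\<ge>1. \<forall>S F.
        closedin (Euclidean_space n) S \<and> (\<lambda>_. 0) \<in> S \<and>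
        F \<subseteq> Metric_space.mcball (usc_fcns n S) (aw_dist n S) (restrict (\<lambda>_. 0) S) R \<longrightarrow>
        (\<forall>\<epsilon>. 0 < \<epsilon> \<and> \<epsilon> \<le> \<epsilon>0 \<longrightarrow>
          (\<exists>N. covering_number n S F \<epsilon> = enat N \<and>
               ln (real N) \<le> (c / \<epsilon>) ^ n * (ln (1 / \<epsilon>)) ^ (n + 1))))"
proof (intro conjI allI impI)
  fix n :: nat and S F
  assume n: "1 \<le> n" and H: "closedin (Euclidean_space n) S \<and> (\<lambda>_. 0) \<in> S \<and>
    Metric_space.mbounded (usc_fcns n S) (aw_dist n S) F"
  show "\<exists>c\<ge>0. \<exists>\<epsilon>0>0. \<forall>\<epsilon>. 0 < \<epsilon> \<and> \<epsilon> \<le> \<epsilon>0 \<longrightarrow> (\<exists>N. covering_number n S F \<epsilon> = enat N \<and>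
      ln (real N) \<le> (c / \<epsilon>) ^ n * (ln (1 / \<epsilon>)) ^ (n + 1))"
    using covering_number_mbounded[OF n, of S F] H by (intro exI[of _ "207::real"]) auto
next
  fix R :: real
  show "\<exists>c\<ge>0. \<exists>\<epsilon>0>0. \<forall>n\<ge>1. \<forall>S F.
        closedin (Euclidean_space n) S \<and> (\<lambda>_. 0) \<in> S \<and>
        F \<subseteq> Metric_space.mcball (usc_fcns n S) (aw_dist n S) (restrict (\<lambda>_. 0) S) R \<longrightarrow>
        (\<forall>\<epsilon>. 0 < \<epsilon> \<and> \<epsilon> \<le> \<epsilon>0 \<longrightarrow>
          (\<exists>N. covering_number n S F \<epsilon> = enat N \<and>
               ln (real N) \<le> (c / \<epsilon>) ^ n * (ln (1 / \<epsilon>)) ^ (n + 1)))"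
  proof (rule exI[of _ "207::real"],
      intro conjI exI[of _ "radius_bound (max 0 (exp 1 * R))"] allI impI)
    show "0 < radius_bound (max 0 (exp 1 * R))" by (simp add: radius_bound_pos)
  qed (simp, blast intro: covering_number_mcball_zero)
qed

end
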